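(* Suppose that $M$ is a commutator monomial of the variables $X_1,\ldots,X_n$, each with multiplicity $1$. Then \[\delta^{\mathrm L}_w(M)=\frac1{w_M}\sum_{k=1}^n \mathrm{cw}^w_{X_k}(M)\,X_k\otimes\mathrm{rem}^{\mathrm L}_{X_k}(M),\] as long as $w_M\neq0$.
   Context: The coefficient ring $K$ satisfies $\mathbb Q\subset K$. The free Lie algebra $\mathrm F^{\mathrm{Lie}}[X_\lambda:\lambda\in\Lambda]$ over $K$ is identified with the commutator Lie subalgebra of the free associative algebra $\mathrm F[X_\lambda:\lambda\in\Lambda]$ generated by the $X_\lambda$. A weighting $w$ is given, assigning to every variable $X_\lambda$ a weight $w_\lambda$ (in $\mathbb Z$ or in $K$). For $P=\sum_{n\ge2}\sum_{(\lambda_1,\ldots,\lambda_n)\in\Lambda^n}c_{(\lambda_1,\ldots,\lambda_n)}X_{\lambda_1}\cdots X_{\lambda_n}\in\mathrm F[X_\lambda:\lambda\in\Lambda]$, one defines \[\delta^{\mathrm L}_w(P)=\sum_{n\ge2}\sum_{(\lambda_1,\ldots,\lambda_n)\in\Lambda^n}\frac{w_{\lambda_n}}{w_{\lambda_1}+\cdots+w_{\lambda_n}}\,c_{(\lambda_1,\ldots,\lambda_n)}\,X_{\lambda_1}\otimes[X_{\lambda_2},\ldots,[X_{\lambda_{n-1}},X_{\lambda_n}]\ldots],\] as long as $w_{\lambda_1}+\cdots+w_{\lambda_n}\neq0$ whenever $c_{(\lambda_1,\ldots,\lambda_n)}\neq0$. A commutator monomial is a commutator expression of the variables, possibly multiplied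 by $-1$ (in degree $1$, $-X_\lambda$ is also considered a commutator monomial). Let $M=\pm[M_1,M_2]$ be a commutator monomial of the variables $X_1,\ldots,X_n$, each with multiplicity $1$ (such an $M$ can be written in a unique way, apart from switches in the commutators and the corresponding sign changes). Let $w_M$, $w_{M_1}$, $w_{M_2}$ be the sums of the weights of the variables in the respective monomials, so that $w_M=w_{M_1}+w_{M_2}$. The co-weight of $X_k$ in $M$ is \[\mathrm{cw}^w_{X_k}(M)=\begin{cases}w_{M_2}&\text{if }X_k\text{ is a variable of }M_1,\\ w_{M_1}&\text{if }X_k\text{ is a variable of }M_2.\end{cases}\] Taking switches in the commutators, one can write $M=(-1)^l[[\ldots[[X_k,N_1],N_2],\ldots,N_{s-1}],N_s]$, where the $N_i$ are other commutator monomials; then the commutator monomial obtained by removing $X_k$ from $M$ to the left is \[\mathrm{rem}^{\mathrm L}_{X_k}(M)=(-1)^l[N_1,[N_2,\ldots[N_{s-1},N_s]\ldots]]\] (which is $(-1)^lN_1$ if $s=1$). *)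

theory Defs
  imports Complex_Main "HOL-Library.Multiset" "HOL-Library.Poly_Mapping"
begin

section \<open>The coefficient ring\<close>

definition contains_rationals :: "'k::comm_ring_1 itself \<Rightarrow> bool" where
  "contains_rationals _ \<longleftrightarrow>
     (\<exists>\<iota> :: rat \<Rightarrow> 'k. inj \<iota> \<and> \<iota> 1 = 1 \<and>
        (\<forall>a b. \<iota> (a + b) = \<iota> a + \<iota> b) \<and> (\<forall>a b. \<iota> (a * b) = \<iota> a * \<iota> b))"

text \<open>The coefficient ring need not be a field. The following is only meaningful for units,
  whose inverse is unique.\<close>

definition ring_inv :: "'k::comm_ring_1 \<Rightarrow> 'k" where
  "ring_inv b = (THE c. b * c = 1)"


section \<open>The free associative algebra and its tensor square\<close>

text \<open>The free associative algebra is the monoid algebra of the free monoid: finitely supported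
  functions on words, with the convolution product that the library provides for functions on
  an (additively written) monoid.\<close>

datatype 'v word = Word (letters: "'v list")

instantiation word :: (type) monoid_add
begin

definition "0 = Word []"

definition "u + v = Word (letters u @ letters v)"

instance
  by standard (simp_all add: zero_word_def plus_word_def)

end

type_synonym ('v, 'k) free_alg = "'v word \<Rightarrow>\<^sub>0 'k"

text \<open>The tensor square is free on pairs of words. As the span of the variables is free, its
  tensor product with the free Lie algebra is a submodule of it.\<close>

type_synonym ('v, 'k) free_alg2 = "('v word \<times> 'v word) \<Rightarrow>\<^sub>0 'k"

definition X :: "'v \<Rightarrow> ('v, 'k::comm_ring_1) free_alg" where
  "X v = Poly_Mapping.single (Word [v]) 1"

definition scale :: "'k \<Rightarrow> ('a \<Rightarrow>\<^sub>0 'k) \<Rightarrow> ('a \<Rightarrow>\<^sub>0 'k::comm_ring_1)" where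
  "scale c p = Poly_Mapping.map ((*) c) p"

definition tensor ::
  "('v, 'k) free_alg \<Rightarrow> ('v, 'k) free_alg \<Rightarrow> ('v, 'k::comm_ring_1) free_alg2"
  (infixr \<open>\<otimes>\<^sub>F\<close> 72) where
  "p \<otimes>\<^sub>F q = (\<Sum>u\<in>Poly_Mapping.keys p. \<Sum>v\<in>Poly_Mapping.keys q.
                 Poly_Mapping.single (u, v) (Poly_Mapping.lookup p u * Poly_Mapping.lookup q v))"

definition commutator :: "'a::ring \<Rightarrow> 'a \<Rightarrow> 'a" where
  "commutator a b = a * b - b * a"


section \<open>Commutator monomials\<close>

datatype 'v cexpr = Var 'v | Comm "'v cexpr" "'v cexpr"

datatype 'v cmonomial = Pos (expr: "'v cexpr") | Neg (expr: "'v cexpr")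

primrec negate :: "'v cmonomial \<Rightarrow> 'v cmonomial" where
  "negate (Pos E) = Neg E"
| "negate (Neg E) = Pos E"

primrec alg_of_expr :: "'v cexpr \<Rightarrow> ('v, 'k::comm_ring_1) free_alg" where
  "alg_of_expr (Var v) = X v"
| "alg_of_expr (Comm A B) = commutator (alg_of_expr A) (alg_of_expr B)"

primrec alg_of :: "'v cmonomial \<Rightarrow> ('v, 'k::comm_ring_1) free_alg" where
  "alg_of (Pos E) = alg_of_expr E"
| "alg_of (Neg E) = - alg_of_expr E"

primrec vars :: "'v cexpr \<Rightarrow> 'v multiset" where
  "vars (Var v) = {#v#}"
| "vars (Comm A B) = vars A + vars B"

definition weight :: "('v \<Rightarrow> 'k::comm_ring_1) \<Rightarrow> 'v cexpr \<Rightarrow> 'k" where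
  "weight w E = (\<Sum>v\<in>#vars E. w v)"

text \<open>The co-weight of a variable in a monomial of degree at least 2, which it occurs in exactly
  once.\<close>

definition coweight :: "('v \<Rightarrow> 'k::comm_ring_1) \<Rightarrow> 'v \<Rightarrow> 'v cmonomial \<Rightarrow> 'k" where
  "coweight w v M = (case expr M of
       Comm M1 M2 \<Rightarrow> if v \<in># vars M1 then weight w M2 else weight w M1
     | Var _ \<Rightarrow> undefined)"

text \<open>\<open>right_nested [N\<^sub>1, \<dots>, N\<^sub>s]\<close> is \<open>[N\<^sub>1, [N\<^sub>2, \<dots> [N\<^sub>s\<^sub>-\<^sub>1, N\<^sub>s] \<dots>]]\<close> and
  \<open>left_nested M [N\<^sub>1, \<dots>, N\<^sub>s]\<close> is \<open>[[\<dots> [[M, N\<^sub>1], N\<^sub>2], \<dots>], N\<^sub>s]\<close>.\<close>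

fun right_nested :: "'v cexpr list \<Rightarrow> 'v cexpr" where
  "right_nested [] = undefined"
| "right_nested [N] = N"
| "right_nested (N # Ns) = Comm N (right_nested Ns)"

definition left_nested :: "'v cexpr \<Rightarrow> 'v cexpr list \<Rightarrow> 'v cexpr" where
  "left_nested M Ns = foldl Comm M Ns"

text \<open>Switch exactly those commutators that have the variable \<open>v\<close> in their second argument. The
  result \<open>(l, Ns)\<close> consists of the number \<open>l\<close> of switches made and the list \<open>Ns\<close> with
  \<open>E = (-1)\<^sup>l left_nested (Var v) Ns\<close>; see \<open>alg_of_left_form\<close> below.\<close>

fun left_form :: "'v \<Rightarrow> 'v cexpr \<Rightarrow> nat \<times> 'v cexpr list" where
  "left_form v (Var _) = (0, [])"
| "left_form v (Comm A B) =
     (if v \<in># vars A then (let (l, Ns) = left_form v A in (l, Ns @ [B]))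
      else (let (l, Ns) = left_form v B in (Suc l, Ns @ [A])))"

primrec rem_left :: "'v \<Rightarrow> 'v cmonomial \<Rightarrow> 'v cmonomial" where
  "rem_left v (Pos E) = (let (l, Ns) = left_form v E in (negate ^^ l) (Pos (right_nested Ns)))"
| "rem_left v (Neg E) = (let (l, Ns) = left_form v E in (negate ^^ Suc l) (Pos (right_nested Ns)))"

lemma alg_of_left_form:
  assumes "v \<in># vars E" and "left_form v E = (l, Ns)"
  shows "alg_of_expr E = ((-1) ^ l * alg_of_expr (left_nested (Var v) Ns) :: ('v, 'k::comm_ring_1) free_alg)"
  using assms
proof (induction E arbitrary: l Ns)
  case (Var u)
  then show ?case by (simp add: left_nested_def)
next
  case (Comm A B)
  have *: "(-1) ^ l * a * b = a * ((-1) ^ l * b)" for a b :: "('v, 'k) free_alg" and l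
    by (cases "even l") simp_all
  show ?case
  proof (cases "v \<in># vars A")
    case True
    then obtain Ns' where "left_form v A = (l, Ns')" "Ns = Ns' @ [B]"
      using Comm.prems by (auto split: prod.splits)
    with Comm.IH(1) True show ?thesis
      by (simp add: left_nested_def commutator_def right_diff_distrib mult.assoc[symmetric] *)
  next
    case False
    then obtain l' Ns' where "left_form v B = (l', Ns')" "Ns = Ns' @ [A]" "l = Suc l'"
      using Comm.prems by (auto split: prod.splits)
    with Comm.IH(2) Comm.prems False show ?thesis
      by (simp add: left_nested_def commutator_def right_diff_distrib mult.assoc[symmetric] *)
  qed
qed


section \<open>The map \<open>\<delta>\<^sup>L\<^sub>w\<close>\<close>

text \<open>Defined for elements without terms of degree below 2 and such that the weight of every
  occurring word is a unit.\<close>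

definition delta_L ::
  "('v \<Rightarrow> 'k) \<Rightarrow> ('v, 'k) free_alg \<Rightarrow> ('v, 'k::comm_ring_1) free_alg2" where
  "delta_L w P = (\<Sum>u \<in> {u \<in> Poly_Mapping.keys P. length (letters u) \<ge> 2}.
     let us = letters u in
       scale (w (last us) * ring_inv (\<Sum>v\<leftarrow>us. w v) * Poly_Mapping.lookup P u)
         (X (hd us) \<otimes>\<^sub>F alg_of_expr (right_nested (map Var (tl us)))))"

end

(* Write M as the sum of X\<^sub>k P\<^sub>k over the first letters. Multilinearity and
   M = (-1)\<^sup>l [\<dots>[X\<^sub>k, N\<^sub>1], \<dots>, N\<^sub>s] force P\<^sub>k = (-1)\<^sup>l N\<^sub>1 \<dots> N\<^sub>s, since only the
   expansion term in which X\<^sub>k stays in front survives. The weighted Dynkin map, which sends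
   X\<^sub>1 \<dots> X\<^sub>m to w\<^sub>m [X\<^sub>1, [\<dots>, X\<^sub>m]], turns left multiplication by a Lie element into its
   adjoint action and multiplies a commutator monomial by its weight (weighted
   Dynkin-Specht-Wever). Hence it sends P\<^sub>k to (-1)\<^sup>l w(N\<^sub>s) [N\<^sub>1, [\<dots>, N\<^sub>s]], and w(N\<^sub>s) is
   the co-weight of X\<^sub>k. All words of M have the same weight, so the denominators factor out. *)
theory Submission
  imports Defs
begin

section \<open>Linear extension\<close>

lemma lookup_scale [simp]: "Poly_Mapping.lookup (scale c p) k = c * Poly_Mapping.lookup p k"
  by (simp add: scale_def Poly_Mapping.map.rep_eq when_def)

lemma scale_add: "scale c (p + q) = scale c p + scale c q"
  by (rule poly_mapping_eqI) (simp add: lookup_add distrib_left)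

lemma scale_diff: "scale c (p - q) = scale c p - scale c q"
  by (rule poly_mapping_eqI) (simp add: lookup_minus right_diff_distrib)

lemma scale_uminus: "scale c (- p) = - scale c p"
  by (rule poly_mapping_eqI) simp

lemma scale_add_left: "scale (c + d) p = scale c p + scale d p"
  by (rule poly_mapping_eqI) (simp add: lookup_add distrib_right)

lemma scale_minus_left: "scale (- c) p = - scale c p"
  by (rule poly_mapping_eqI) simp

lemma scale_scale [simp]: "scale c (scale d p) = scale (c * d) p"
  by (rule poly_mapping_eqI) (simp add: mult.assoc)

lemma scale_zero [simp]: "scale c 0 = 0" "scale 0 p = 0"
  by (rule poly_mapping_eqI, simp)+

lemma scale_one [simp]: "scale 1 p = p"
  by (rule poly_mapping_eqI) simp

lemma scale_single: "scale c (Poly_Mapping.single k d) = Poly_Mapping.single k (c * d)"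
  by (rule poly_mapping_eqI) (simp add: lookup_single when_def)

lemma scale_sum: "scale c (\<Sum>i\<in>I. f i) = (\<Sum>i\<in>I. scale c (f i))"
  by (induction I rule: infinite_finite_induct) (simp_all add: scale_add)

lemma scale_mult_left: "scale c p * q = scale c (p * q)"
  for p q :: "'a::monoid_add \<Rightarrow>\<^sub>0 'k::comm_ring_1"
  by (simp add: scale_def mult_map_scale_conv_mult mult.assoc)

text \<open>The empty word commutes with every word, so embedded scalars are central although the
  product is not commutative. This lets scalars leave the right factor.\<close>

lemma single_zero_mult_commute:
  "p * Poly_Mapping.single 0 c = Poly_Mapping.single 0 c * p"
  for p :: "'a::monoid_add \<Rightarrow>\<^sub>0 'k::comm_ring_1"
proof (induction p rule: update_induct)
  case (update f a b)
  have "Poly_Mapping.update a b f = f + Poly_Mapping.single a b"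
    using update(1)
    by (intro poly_mapping_eqI)
      (auto simp: lookup_update lookup_add lookup_single when_def in_keys_iff)
  with update show ?case
    by (simp add: distrib_left distrib_right mult_single mult.commute)
qed simp

lemma scale_mult_right: "p * scale c q = scale c (p * q)"
  for p q :: "'a::monoid_add \<Rightarrow>\<^sub>0 'k::comm_ring_1"
  by (simp add: scale_def mult_map_scale_conv_mult mult.assoc[symmetric] single_zero_mult_commute)

text \<open>\<open>left_quot\<close> and \<open>dynkin\<close> are instances, so linearity is proved
  only once.\<close>

definition lin_ext :: "('a \<Rightarrow> ('b \<Rightarrow>\<^sub>0 'k)) \<Rightarrow> ('a \<Rightarrow>\<^sub>0 'k::comm_ring_1) \<Rightarrow> ('b \<Rightarrow>\<^sub>0 'k)" where
  "lin_ext f p = (\<Sum>u\<in>Poly_Mapping.keys p. scale (Poly_Mapping.lookup p u) (f u))"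

text \<open>Supports may shrink under addition or scaling. A common index set makes the sums
  comparable term by term.\<close>

lemma lin_ext_superset:
  assumes "finite S" "Poly_Mapping.keys p \<subseteq> S"
  shows "lin_ext f p = (\<Sum>u\<in>S. scale (Poly_Mapping.lookup p u) (f u))"
  unfolding lin_ext_def using assms by (intro sum.mono_neutral_left) (auto simp: in_keys_iff)

lemma lin_ext_cong:
  "(\<And>u. u \<in> Poly_Mapping.keys p \<Longrightarrow> f u = g u) \<Longrightarrow> lin_ext f p = lin_ext g p"
  by (simp add: lin_ext_def)

lemma lin_ext_zero [simp]: "lin_ext f 0 = 0"
  by (simp add: lin_ext_def)

lemma lin_ext_add: "lin_ext f (p + q) = lin_ext f p + lin_ext f q"
proof -
  let ?S = "Poly_Mapping.keys p \<union> Poly_Mapping.keys q"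
  have "Poly_Mapping.keys (p + q) \<subseteq> ?S"
    by (rule keys_add)
  then show ?thesis
    by (simp add: lin_ext_superset[of ?S] lookup_add scale_add_left sum.distrib)
qed

lemma lin_ext_scale: "lin_ext f (scale c p) = scale c (lin_ext f p)"
proof -
  have "Poly_Mapping.keys (scale c p) \<subseteq> Poly_Mapping.keys p"
    by (auto simp: in_keys_iff)
  then show ?thesis
    by (simp add: lin_ext_superset[of "Poly_Mapping.keys p"] scale_sum)
qed

lemma lin_ext_uminus: "lin_ext f (- p) = - lin_ext f p"
  using lin_ext_scale[of f "-1" p] by (simp add: scale_minus_left)

lemma lin_ext_diff: "lin_ext f (p - q) = lin_ext f p - lin_ext f q"
  using lin_ext_add[of f p "- q"] by (simp add: lin_ext_uminus)

lemma lin_ext_single: "lin_ext f (Poly_Mapping.single u c) = scale c (f u)"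
  by (cases "c = 0") (simp_all add: lin_ext_def)

lemma linear_lin_ext:
  assumes add: "\<And>p q. h (p + q) = h p + h q" and scale: "\<And>c p. h (scale c p) = scale c (h p)"
  shows "h (lin_ext f p) = lin_ext (\<lambda>u. h (f u)) p"
proof -
  have "h 0 = 0"
    using scale[of 0 0] by simp
  then have "h (\<Sum>u\<in>U. scale (Poly_Mapping.lookup p u) (f u)) =
      (\<Sum>u\<in>U. h (scale (Poly_Mapping.lookup p u) (f u)))" for U
    by (induction U rule: infinite_finite_induct) (simp_all add: add)
  then show ?thesis
    by (simp add: lin_ext_def scale)
qed

lemma lin_ext_self: "lin_ext (\<lambda>u. Poly_Mapping.single u 1) p = p"
proof (rule poly_mapping_eqI)
  fix k
  have "Poly_Mapping.lookup (lin_ext (\<lambda>u. Poly_Mapping.single u 1) p) k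
      = (\<Sum>u\<in>Poly_Mapping.keys p. if u = k then Poly_Mapping.lookup p u else 0)"
    by (simp add: lin_ext_def lookup_sum lookup_single when_def if_distrib cong: if_cong)
  then show "Poly_Mapping.lookup (lin_ext (\<lambda>u. Poly_Mapping.single u 1) p) k
      = Poly_Mapping.lookup p k"
    by (simp add: in_keys_iff)
qed

lemma lin_ext_eqI:
  assumes "\<And>p q. h (p + q) = h p + h q" and "\<And>c p. h (scale c p) = scale c (h p)"
  shows "h p = lin_ext (\<lambda>u. h (Poly_Mapping.single u 1)) p"
  using linear_lin_ext[of h "\<lambda>u. Poly_Mapping.single u 1" p] assms by (simp add: lin_ext_self)

text \<open>Both sides are linear in \<open>p\<close>, so single words suffice. This gives the
  recursion on the first letter for both maps below.\<close>

lemma lin_ext_X_mult: "lin_ext f (X v * p) = lin_ext (\<lambda>u. f (Word [v] + u)) p"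
proof -
  have "lin_ext f (X v * p) = lin_ext (\<lambda>u. lin_ext f (X v * Poly_Mapping.single u 1)) p"
    by (rule lin_ext_eqI) (simp_all add: distrib_left lin_ext_add scale_mult_right lin_ext_scale)
  then show ?thesis
    by (simp add: X_def mult_single lin_ext_single)
qed

lemma tensor_X: "X v \<otimes>\<^sub>F q = lin_ext (\<lambda>u. Poly_Mapping.single (Word [v], u) 1) q"
  by (simp add: tensor_def X_def lin_ext_def scale_single)

lemma tensor_X_scale: "X v \<otimes>\<^sub>F scale c q = scale c (X v \<otimes>\<^sub>F q)"
  by (simp add: tensor_X lin_ext_scale)

lemma tensor_X_lin_ext: "X v \<otimes>\<^sub>F lin_ext f p = lin_ext (\<lambda>u. X v \<otimes>\<^sub>F f u) p"
  by (rule linear_lin_ext) (simp_all add: tensor_X lin_ext_add lin_ext_scale)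


section \<open>Words of a commutator monomial\<close>

text \<open>Both products in a commutator concatenate the same letters. Cancellation can only remove
  words, hence just one inclusion.\<close>

lemma keys_alg_of_expr:
  "u \<in> Poly_Mapping.keys (alg_of_expr E :: ('v, 'k::comm_ring_1) free_alg) \<Longrightarrow>
     mset (letters u) = vars E"
proof (induction E arbitrary: u)
  case (Var v)
  then show ?case by (simp add: X_def)
next
  case (Comm A B)
  let ?a = "alg_of_expr A :: ('v, 'k) free_alg" and ?b = "alg_of_expr B :: ('v, 'k) free_alg"
  have "u \<in> Poly_Mapping.keys (?a * ?b) \<union> Poly_Mapping.keys (?b * ?a)"
    using Comm.prems by (auto simp: commutator_def in_keys_iff lookup_minus)
  with keys_mult[of ?a ?b] keys_mult[of ?b ?a]
  obtain s t where "u = s + t \<or> u = t + s" "s \<in> Poly_Mapping.keys ?a" "t \<in> Poly_Mapping.keys ?b"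
    by blast
  with Comm.IH show ?case
    by (auto simp: plus_word_def)
qed

lemma vars_nonempty: "vars E \<noteq> {#}"
  by (induction E) simp_all

lemma word_add_eq_0_iff: "u + v = 0 \<longleftrightarrow> u = 0 \<and> v = (0 :: 'v word)"
  by (cases u; cases v) (simp add: plus_word_def zero_word_def)

lemma zero_notin_keys_alg_of_expr: "0 \<notin> Poly_Mapping.keys (alg_of_expr E)"
  using keys_alg_of_expr[of 0 E] vars_nonempty[of E] by (auto simp: zero_word_def)

lemma zero_notin_keys_mult:
  "0 \<notin> Poly_Mapping.keys p \<or> 0 \<notin> Poly_Mapping.keys q \<Longrightarrow> 0 \<notin> Poly_Mapping.keys (p * q)"
  for p q :: "('v, 'k::comm_ring_1) free_alg"
  using keys_mult[of p q] by (auto simp: word_add_eq_0_iff dest: sym)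


section \<open>The part starting with a given letter\<close>

text \<open>The factor P_v in P = c + \<Sum> X_v P_v. The empty word is tested for because
  \<open>hd []\<close> is unspecified.\<close>

definition left_quot :: "'v \<Rightarrow> ('v, 'k) free_alg \<Rightarrow> ('v, 'k::comm_ring_1) free_alg" where
  "left_quot v = lin_ext (\<lambda>u. if u \<noteq> 0 \<and> hd (letters u) = v
                              then Poly_Mapping.single (Word (tl (letters u))) 1 else 0)"

lemma left_quot_X_mult: "left_quot v (X u * p) = (if u = v then p else 0)"
proof -
  have "left_quot v (X u * p) =
      lin_ext (\<lambda>t. if u = v then Poly_Mapping.single t 1 else 0) p"
    unfolding left_quot_def lin_ext_X_mult
    by (intro lin_ext_cong) (simp add: plus_word_def zero_word_def)
  then show ?thesis
    by (cases "u = v") (simp_all add: lin_ext_self, simp add: lin_ext_def)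
qed

lemma left_quot_diff: "left_quot v (p - q) = left_quot v p - left_quot v q"
  by (simp add: left_quot_def lin_ext_diff)

text \<open>Every word of E starts with a letter of E. The trailing factor \<open>p\<close> lets the
  induction use [A,B]p = A(Bp) - B(Ap).\<close>

lemma left_quot_expr_mult_0: "v \<notin># vars E \<Longrightarrow> left_quot v (alg_of_expr E * p) = 0"
  by (induction E arbitrary: p)
    (simp_all add: left_quot_X_mult commutator_def left_diff_distrib left_quot_diff mult.assoc)

text \<open>In [A,B]p = A(Bp) - B(Ap) only the term led by the half containing \<open>v\<close>
  survives. The other half joins the trailing factor, which is why \<open>p\<close> is arbitrary.
  The minus sign in the second case is the switch counted by \<open>left_form\<close>.\<close>

lemma left_quot_expr_mult:
  assumes "count (vars E) v = 1" and "left_form v E = (l, Ns)"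
  shows "left_quot v (alg_of_expr E * p) = scale ((-1) ^ l) (prod_list (map alg_of_expr Ns) * p)"
  using assms
proof (induction E arbitrary: l Ns p)
  case (Var u)
  then show ?case by (simp add: left_quot_X_mult split: if_splits)
next
  case (Comm A B)
  show ?case
  proof (cases "v \<in># vars A")
    case True
    \<comment> \<open>Multiplicity one keeps \<open>v\<close> out of B, so B(Ap) contributes
      nothing.\<close>
    then have "count (vars A) v = 1" "v \<notin># vars B"
      using Comm.prems(1) by (simp_all add: not_in_iff flip: count_greater_zero_iff)
    moreover obtain Ns' where "left_form v A = (l, Ns')" "Ns = Ns' @ [B]"
      using Comm.prems True by (auto split: prod.splits)
    ultimately show ?thesis
      using Comm.IH(1)
      by (simp add: commutator_def left_diff_distrib left_quot_diff mult.assoc left_quot_expr_mult_0)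
  next
    case False
    then have "count (vars B) v = 1"
      using Comm.prems(1) by (simp add: not_in_iff)
    moreover obtain l' Ns' where "left_form v B = (l', Ns')" "Ns = Ns' @ [A]" "l = Suc l'"
      using Comm.prems False by (auto split: prod.splits)
    ultimately show ?thesis
      using Comm.IH(2) False
      by (simp add: commutator_def left_diff_distrib left_quot_diff mult.assoc left_quot_expr_mult_0
          scale_minus_left)
  qed
qed


section \<open>The weighted Dynkin map\<close>

text \<open>Junk at the empty word; \<open>0 \<notin> Poly_Mapping.keys p\<close> below keeps it out.\<close>

definition dynkin_word :: "('v \<Rightarrow> 'k) \<Rightarrow> 'v word \<Rightarrow> ('v, 'k::comm_ring_1) free_alg" where
  "dynkin_word w u = scale (w (last (letters u))) (alg_of_expr (right_nested (map Var (letters u))))"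

text \<open>With all weights 1 this is the classical right-nested Dynkin operator on nonempty
  words.\<close>

definition dynkin :: "('v \<Rightarrow> 'k) \<Rightarrow> ('v, 'k) free_alg \<Rightarrow> ('v, 'k::comm_ring_1) free_alg" where
  "dynkin w = lin_ext (dynkin_word w)"

lemma commutator_scale_right: "commutator p (scale c q) = scale c (commutator p q)"
  for p q :: "('v, 'k::comm_ring_1) free_alg"
  by (simp add: commutator_def scale_mult_left scale_mult_right scale_diff)

text \<open>A letter put in front of a nonempty word leaves the last letter, hence the weight
  factor, unchanged and adds one outer bracket.\<close>

lemma dynkin_word_Cons:
  assumes "u \<noteq> 0"
  shows "dynkin_word w (Word [v] + u) = commutator (X v) (dynkin_word w u)"
proof (cases u)
  case (Word us)
  with assms obtain a as where "us = a # as"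
    by (cases us) (auto simp: zero_word_def)
  with Word show ?thesis
    by (simp add: dynkin_word_def plus_word_def commutator_scale_right)
qed

lemma dynkin_diff: "dynkin w (p - q) = dynkin w p - dynkin w q"
  by (simp add: dynkin_def lin_ext_diff)

lemma dynkin_scale: "dynkin w (scale c p) = scale c (dynkin w p)"
  by (simp add: dynkin_def lin_ext_scale)

lemma dynkin_X_mult:
  assumes "0 \<notin> Poly_Mapping.keys p"
  shows "dynkin w (X v * p) = commutator (X v) (dynkin w p)"
proof -
  have "dynkin w (X v * p) = lin_ext (\<lambda>u. commutator (X v) (dynkin_word w u)) p"
    unfolding dynkin_def lin_ext_X_mult
    using assms by (intro lin_ext_cong dynkin_word_Cons) auto
  also have "\<dots> = commutator (X v) (dynkin w p)"
    unfolding dynkin_def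
    by (rule linear_lin_ext[symmetric])
      (simp_all add: commutator_scale_right, simp add: commutator_def algebra_simps)
  finally show ?thesis .
qed

text \<open>With D the image of p, [A,B]p = A(Bp) - B(Ap) goes to [A,[B,D]] - [B,[A,D]], which is
  [[A,B],D] by the Jacobi identity. Ap and Bp again have no constant term.\<close>

lemma dynkin_expr_mult:
  assumes "0 \<notin> Poly_Mapping.keys p"
  shows "dynkin w (alg_of_expr E * p) = commutator (alg_of_expr E) (dynkin w p)"
  using assms
proof (induction E arbitrary: p)
  case (Var v)
  then show ?case by (simp add: dynkin_X_mult)
next
  case (Comm A B)
  then show ?case
    by (simp add: commutator_def left_diff_distrib right_diff_distrib dynkin_diff mult.assoc
        zero_notin_keys_mult)
qed

lemma weight_Comm: "weight w (Comm A B) = weight w A + weight w B"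
  by (simp add: weight_def)

text \<open>Weighted Dynkin-Specht-Wever: AB goes to w_B [A,B] and BA to w_A [B,A], so the
  difference is (w_A + w_B) [A,B].\<close>

lemma dynkin_expr: "dynkin w (alg_of_expr E) = scale (weight w E) (alg_of_expr E)"
proof (induction E)
  case (Var v)
  then show ?case
    by (simp add: dynkin_def X_def lin_ext_single dynkin_word_def weight_def)
next
  case (Comm A B)
  have "dynkin w (alg_of_expr (Comm A B)) =
      scale (weight w B) (commutator (alg_of_expr A) (alg_of_expr B))
        - scale (weight w A) (commutator (alg_of_expr B) (alg_of_expr A))"
    by (simp add: commutator_def[of "alg_of_expr A" "alg_of_expr B"] dynkin_diff dynkin_expr_mult
        zero_notin_keys_alg_of_expr Comm commutator_scale_right scale_diff
        del: alg_of_expr.simps add: alg_of_expr.simps(2))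
  also have "\<dots> = scale (weight w (Comm A B)) (alg_of_expr (Comm A B))"
    by (simp add: weight_Comm scale_add_left commutator_def scale_diff)
  finally show ?case .
qed

text \<open>All factors but the last act by brackets; the last one yields its weight by
  \<open>dynkin_expr\<close>.\<close>

lemma dynkin_prod_list:
  assumes "Ns \<noteq> []"
  shows "dynkin w (prod_list (map alg_of_expr Ns)) =
           scale (weight w (last Ns)) (alg_of_expr (right_nested Ns))"
  using assms
proof (induction Ns rule: right_nested.induct)
  case (3 N N' Ns)
  have "0 \<notin> Poly_Mapping.keys (prod_list (map alg_of_expr (N' # Ns)) :: ('a, 'b) free_alg)"
    by (simp add: zero_notin_keys_mult zero_notin_keys_alg_of_expr)
  then have "dynkin w (prod_list (map alg_of_expr (N # N' # Ns))) =
      commutator (alg_of_expr N) (dynkin w (prod_list (map alg_of_expr (N' # Ns))))"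
    by (simp add: dynkin_expr_mult)
  with 3 show ?case
    by (simp add: commutator_scale_right)
qed (simp_all add: dynkin_expr)


section \<open>Computation of \<open>\<delta>\<^sup>L\<^sub>w\<close>\<close>

text \<open>Equal word weights give a common denominator; the remaining sum is grouped by first
  letters.\<close>

lemma delta_L_homogeneous:
  fixes P :: "('v, 'k::comm_ring_1) free_alg"
  assumes "finite S"
    and keys: "\<And>u. u \<in> Poly_Mapping.keys P \<Longrightarrow>
      length (letters u) \<ge> 2 \<and> hd (letters u) \<in> S \<and> (\<Sum>v\<leftarrow>letters u. w v) = W"
  shows "delta_L w P = scale (ring_inv W) (\<Sum>v\<in>S. X v \<otimes>\<^sub>F dynkin w (left_quot v P))"
proof -
  let ?D = "\<lambda>u. dynkin_word w (Word (tl (letters u)))"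
  have "dynkin w (left_quot v P) =
      lin_ext (\<lambda>u. if u \<noteq> 0 \<and> hd (letters u) = v then ?D u else 0) P" for v
  proof -
    have "dynkin w (left_quot v P) = lin_ext (\<lambda>u. dynkin w
        (if u \<noteq> 0 \<and> hd (letters u) = v then Poly_Mapping.single (Word (tl (letters u))) 1 else 0)) P"
      unfolding left_quot_def
      by (rule linear_lin_ext) (simp_all add: dynkin_scale, simp add: dynkin_def lin_ext_add)
    also have "\<dots> = lin_ext (\<lambda>u. if u \<noteq> 0 \<and> hd (letters u) = v then ?D u else 0) P"
      by (intro lin_ext_cong) (simp add: dynkin_def lin_ext_single)
    finally show ?thesis .
  qed
  then have "(\<Sum>v\<in>S. X v \<otimes>\<^sub>F dynkin w (left_quot v P)) =
      (\<Sum>v\<in>S. \<Sum>u\<in>Poly_Mapping.keys P. scale (Poly_Mapping.lookup P u)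
        (X v \<otimes>\<^sub>F (if u \<noteq> 0 \<and> hd (letters u) = v then ?D u else 0)))"
    by (simp add: tensor_X_lin_ext) (simp add: lin_ext_def)
  also have "\<dots> = (\<Sum>u\<in>Poly_Mapping.keys P. \<Sum>v\<in>S. scale (Poly_Mapping.lookup P u)
        (X v \<otimes>\<^sub>F (if u \<noteq> 0 \<and> hd (letters u) = v then ?D u else 0)))"
    by (rule sum.swap)
  \<comment> \<open>A word has only one first letter, so the inner sum over S has a single nonzero
    term.\<close>
  also have "\<dots> = (\<Sum>u\<in>Poly_Mapping.keys P. scale (Poly_Mapping.lookup P u)
        (X (hd (letters u)) \<otimes>\<^sub>F ?D u))"
  proof (rule sum.cong)
    fix u assume u: "u \<in> Poly_Mapping.keys P"
    have "(\<Sum>v\<in>S. scale (Poly_Mapping.lookup P u)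
          (X v \<otimes>\<^sub>F (if u \<noteq> 0 \<and> hd (letters u) = v then ?D u else 0))) =
        (\<Sum>v\<in>S. if v = hd (letters u)
          then scale (Poly_Mapping.lookup P u) (X (hd (letters u)) \<otimes>\<^sub>F ?D u) else 0)"
      using keys[OF u] by (intro sum.cong) (auto simp: tensor_X zero_word_def)
    then show "(\<Sum>v\<in>S. scale (Poly_Mapping.lookup P u)
          (X v \<otimes>\<^sub>F (if u \<noteq> 0 \<and> hd (letters u) = v then ?D u else 0))) =
        scale (Poly_Mapping.lookup P u) (X (hd (letters u)) \<otimes>\<^sub>F ?D u)"
      using keys[OF u] \<open>finite S\<close> by simp
  qed simp
  finally have *: "(\<Sum>v\<in>S. X v \<otimes>\<^sub>F dynkin w (left_quot v P)) = \<dots>" .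
  have "{u \<in> Poly_Mapping.keys P. length (letters u) \<ge> 2} = Poly_Mapping.keys P"
    using keys by auto
  \<comment> \<open>Degree at least 2 keeps the tail nonempty, so the Dynkin map on the tail sees
    the weight required by \<open>delta_L\<close>.\<close>
  moreover have "last (tl (letters u)) = last (letters u)" if "u \<in> Poly_Mapping.keys P" for u
    using keys[OF that] by (cases "letters u") (auto simp: last_tl)
  ultimately show ?thesis
    unfolding * delta_L_def Let_def scale_sum
    using keys by (auto intro!: sum.cong simp: dynkin_word_def tensor_X_scale mult_ac)
qed

lemma alg_of_negate_pow: "alg_of ((negate ^^ l) M) = scale ((-1) ^ l) (alg_of M)"
proof (induction l)
  case (Suc l)
  have "alg_of (negate N) = (- alg_of N :: ('a, 'b) free_alg)" for N
    by (cases N) simp_all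
  with Suc show ?case
    by (simp add: scale_minus_left)
qed simp

lemma dynkin_left_quot:
  fixes w :: "'v \<Rightarrow> 'k::comm_ring_1"
  assumes "count (vars (expr M)) v = 1" and "expr M = Comm A B"
  shows "dynkin w (left_quot v (alg_of M)) = scale (coweight w v M) (alg_of (rem_left v M))"
proof -
  obtain l Ns where lf: "left_form v (expr M) = (l, Ns)"
    by fastforce
  \<comment> \<open>The outermost commutator is appended last, so \<open>last Ns\<close> is the half
    of M without \<open>v\<close>.\<close>
  then have Ns: "Ns \<noteq> []" and cw: "weight w (last Ns) = coweight w v M"
    using assms(2) by (auto simp: coweight_def split: if_splits prod.splits)
  have "left_quot v (alg_of_expr (expr M) :: ('v, 'k) free_alg) =
      scale ((-1) ^ l) (prod_list (map alg_of_expr Ns))"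
    using left_quot_expr_mult[OF assms(1) lf, of 1] by simp
  then have "dynkin w (left_quot v (alg_of_expr (expr M))) =
      scale ((-1) ^ l * coweight w v M) (alg_of_expr (right_nested Ns))"
    by (simp add: dynkin_scale dynkin_prod_list[OF Ns] cw)
  \<comment> \<open>For \<open>Neg\<close> the extra sign matches the \<open>Suc l\<close> in
    \<open>rem_left\<close>.\<close>
  with lf show ?thesis
    by (cases M) (simp_all add: alg_of_negate_pow left_quot_def dynkin_def lin_ext_uminus
        scale_minus_left scale_uminus mult.commute del: funpow.simps)
qed

theorem theorem5p1:
  fixes x :: "nat \<Rightarrow> 'v" and n :: nat and w :: "'v \<Rightarrow> 'k::comm_ring_1" and M :: "'v cmonomial"
  assumes "contains_rationals TYPE('k)"
    and "n \<ge> 2"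
    and "inj_on x {1..n}"
    and "vars (expr M) = image_mset x (mset_set {1..n})"
    and "weight w (expr M) \<noteq> 0"
    and "(\<forall>v. w v \<in> \<int>) \<or> weight w (expr M) dvd 1"
  shows "delta_L w (alg_of M) =
         scale (ring_inv (weight w (expr M)))
           (\<Sum>k = 1..n. scale (coweight w (x k) M) (X (x k) \<otimes>\<^sub>F alg_of (rem_left (x k) M)))"
proof -
  \<comment> \<open>Injectivity of \<open>x\<close> turns the multiset of variables into a set,
    giving each multiplicity one.\<close>
  have vars: "vars (expr M) = mset_set (x ` {1..n})"
    using assms(3,4) by (simp add: image_mset_mset_set)
  have size: "size (vars (expr M)) = n"
    using assms(4) by simp
  then obtain A B where AB: "expr M = Comm A B"
    using assms(2) by (cases "expr M") auto
  \<comment> \<open>Each word of M is an arrangement of all its variables, hence has degree n and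
    weight w_M.\<close>
  have "length (letters u) \<ge> 2 \<and> hd (letters u) \<in> x ` {1..n} \<and>
      (\<Sum>v\<leftarrow>letters u. w v) = weight w (expr M)"
    if "u \<in> Poly_Mapping.keys (alg_of M :: ('v, 'k) free_alg)" for u
  proof -
    have "u \<in> Poly_Mapping.keys (alg_of_expr (expr M) :: ('v, 'k) free_alg)"
      using that by (cases M) simp_all
    then have mset: "mset (letters u) = vars (expr M)"
      by (rule keys_alg_of_expr)
    then have len: "length (letters u) \<ge> 2"
      using size assms(2) by (metis size_mset)
    have "set (letters u) = x ` {1..n}"
      using mset vars by (metis finite_atLeastAtMost finite_imageI finite_set_mset_mset_set set_mset_mset)
    moreover have "hd (letters u) \<in> set (letters u)"
      using len by (intro hd_in_set) auto
    moreover have "(\<Sum>v\<leftarrow>letters u. w v) = weight w (expr M)"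
      by (simp add: weight_def flip: mset sum_mset_sum_list)
    ultimately show ?thesis
      using len by simp
  qed
  then have "delta_L w (alg_of M) = scale (ring_inv (weight w (expr M)))
      (\<Sum>v\<in>x ` {1..n}. X v \<otimes>\<^sub>F dynkin w (left_quot v (alg_of M)))"
    by (intro delta_L_homogeneous) simp_all
  also have "(\<Sum>v\<in>x ` {1..n}. X v \<otimes>\<^sub>F dynkin w (left_quot v (alg_of M))) =
      (\<Sum>k = 1..n. scale (coweight w (x k) M) (X (x k) \<otimes>\<^sub>F alg_of (rem_left (x k) M)))"
    unfolding sum.reindex[OF assms(3)] comp_def
  proof (rule sum.cong)
    fix k assume "k \<in> {1..n}"
    then have "count (vars (expr M)) (x k) = 1"
      unfolding vars by simp
    then show "X (x k) \<otimes>\<^sub>F dynkin w (left_quot (x k) (alg_of M)) =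
        scale (coweight w (x k) M) (X (x k) \<otimes>\<^sub>F alg_of (rem_left (x k) M))"
      using AB by (simp add: dynkin_left_quot tensor_X_scale)
  qed simp
  finally show ?thesis .
qed

end
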